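(* Let $1<p\le\infty$ and let $\Omega\subset\mathbb{R}^N$, $N\ge 2$, be a (not necessarily bounded) domain with boundary $\Gamma$ satisfying $\Gamma=\partial\left(\mathbb{R}^N\setminus\overline{\Omega}\right)$. For $\varepsilon>0$ let $u^\varepsilon$ be the bounded viscosity solution of $$u-\varepsilon^2\Delta_p^G u=0 \ \text{ in } \Omega,\qquad u=1 \ \text{ on } \Gamma .$$ Then $$\lim_{\varepsilon\to 0^+}\varepsilon\log\left\{u^\varepsilon(x)\right\}=-\sqrt{p'}\,d_\Gamma(x)\quad\text{for any } x\in\overline{\Omega}.$$
   Context: Here $d_\Gamma(x)$ is the distance of $x$ to $\Gamma$, and $p'$ is the conjugate exponent of $p$, i.e. $1/p+1/p'=1$ ($p'=1$ if $p=\infty$). The game-theoretic (normalized) $p$-laplacian is formally $\Delta_p^G u=\frac1p|\nabla u|^{2-p}\,\mathrm{div}\{|\nabla u|^{p-2}\nabla u\}$ for $1<p<\infty$, that is $\frac1p\Delta u+\left(1-\frac2p\right)\frac{\langle\nabla^2u\,\nabla u,\nabla u\rangle}{|\nabla u|^2}$, and $\Delta_\infty^G u=\frac{\langle\nabla^2u\,\nabla u,\nabla u\rangle}{|\nabla u|^2}$ for $p=\infty$ (formally the same formula with $1/p=0$). Solutions are viscosity solutions, continuous on $\overline\Omega$, where the singularity at critical points is handled by semicontinuous envelopes: if $\varphi\in C^2$ and $u-\varphi$ has a local maximum (resp. minimum) at $x\in\Omega$, then $u(x)\le\varepsilon^2\Delta_p^G\varphi(x)$ (resp. $\ge$) if $\nabla\varphi(x)\ne0$,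 while if $\nabla\varphi(x)=0$ then $u(x)\le\varepsilon^2\max_{|e|=1}\left[\frac1p\Delta\varphi(x)+\left(1-\frac2p\right)\langle\nabla^2\varphi(x)e,e\rangle\right]$ (resp. $u(x)\ge\varepsilon^2\min_{|e|=1}[\cdots]$). *)

theory Defs
  imports "HOL-Analysis.Analysis"
begin

text \<open>The exponent \<open>p\<close> is an extended real. Since \<open>1 / \<infinity> = 0\<close> there, \<open>real_of_ereal (1 / p)\<close>
  is the number \<open>1/p\<close> of the paper both for finite \<open>p\<close> and for \<open>p = \<infinity>\<close>, and one formula covers
  both cases of the operator.\<close>

text \<open>\<open>\<phi> \<in> C\<^sup>2(\<Omega>)\<close>, with gradient \<open>G\<close> and Hessian matrix \<open>H\<close>.\<close>

definition C2_with ::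
    "(real^'n) set \<Rightarrow> (real^'n \<Rightarrow> real) \<Rightarrow> (real^'n \<Rightarrow> real^'n) \<Rightarrow> (real^'n \<Rightarrow> real^'n^'n) \<Rightarrow> bool"
  where "C2_with \<Omega> \<phi> G H \<longleftrightarrow>
    (\<forall>x\<in>\<Omega>. GDERIV \<phi> x :> G x) \<and>
    (\<forall>x\<in>\<Omega>. (G has_derivative (\<lambda>h. H x *v h)) (at x)) \<and>
    continuous_on \<Omega> H"

text \<open>The game-theoretic \<open>p\<close>-Laplacian evaluated at a gradient \<open>g \<noteq> 0\<close> and a Hessian \<open>H\<close>.\<close>

definition game_plap :: "ereal \<Rightarrow> real^'n \<Rightarrow> real^'n^'n \<Rightarrow> real"
  where "game_plap p g H =
    real_of_ereal (1 / p) * trace H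
      + (1 - 2 * real_of_ereal (1 / p)) * (((H *v g) \<bullet> g) / (norm g)\<^sup>2)"

text \<open>The bracket whose maximum and minimum over unit vectors \<open>e\<close> replace the operator
  where the gradient vanishes.\<close>

definition game_plap_dir :: "ereal \<Rightarrow> real^'n^'n \<Rightarrow> real^'n \<Rightarrow> real"
  where "game_plap_dir p H e =
    real_of_ereal (1 / p) * trace H
      + (1 - 2 * real_of_ereal (1 / p)) * ((H *v e) \<bullet> e)"

text \<open>Upper and lower semicontinuous envelopes. Supremum and infimum are attained, because the unit
  sphere is nonempty and compact and \<open>game_plap_dir p H\<close> is continuous.\<close>

definition game_plap_upper :: "ereal \<Rightarrow> real^'n \<Rightarrow> real^'n^'n \<Rightarrow> real"
  where "game_plap_upper p g H =
    (if g \<noteq> 0 then game_plap p g H else (SUP e\<in>sphere 0 1. game_plap_dir p H e))"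

definition game_plap_lower :: "ereal \<Rightarrow> real^'n \<Rightarrow> real^'n^'n \<Rightarrow> real"
  where "game_plap_lower p g H =
    (if g \<noteq> 0 then game_plap p g H else (INF e\<in>sphere 0 1. game_plap_dir p H e))"

text \<open>Viscosity sub- and supersolutions of \<open>u - \<epsilon>\<^sup>2 \<Delta>\<^sub>p\<^sup>G u = 0\<close> in the open set \<open>\<Omega>\<close>.\<close>

definition visc_subsolution :: "ereal \<Rightarrow> real \<Rightarrow> (real^'n) set \<Rightarrow> (real^'n \<Rightarrow> real) \<Rightarrow> bool"
  where "visc_subsolution p \<epsilon> \<Omega> u \<longleftrightarrow>
    (\<forall>\<phi> G H. C2_with \<Omega> \<phi> G H \<longrightarrow>
      (\<forall>x\<in>\<Omega>. (\<forall>\<^sub>F y in nhds x. u y - \<phi> y \<le> u x - \<phi> x) \<longrightarrow>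
        u x \<le> \<epsilon>\<^sup>2 * game_plap_upper p (G x) (H x)))"

definition visc_supersolution :: "ereal \<Rightarrow> real \<Rightarrow> (real^'n) set \<Rightarrow> (real^'n \<Rightarrow> real) \<Rightarrow> bool"
  where "visc_supersolution p \<epsilon> \<Omega> u \<longleftrightarrow>
    (\<forall>\<phi> G H. C2_with \<Omega> \<phi> G H \<longrightarrow>
      (\<forall>x\<in>\<Omega>. (\<forall>\<^sub>F y in nhds x. u x - \<phi> x \<le> u y - \<phi> y) \<longrightarrow>
        \<epsilon>\<^sup>2 * game_plap_lower p (G x) (H x) \<le> u x))"

text \<open>Bounded viscosity solutions of the Dirichlet problem with boundary value \<open>1\<close>. Only the values
  of \<open>u\<close> on \<open>closure \<Omega>\<close> matter.\<close>

definition bounded_visc_solution :: "ereal \<Rightarrow> real \<Rightarrow> (real^'n) set \<Rightarrow> (real^'n \<Rightarrow> real) \<Rightarrow> bool"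
  where "bounded_visc_solution p \<epsilon> \<Omega> u \<longleftrightarrow>
    continuous_on (closure \<Omega>) u \<and>
    bounded (u ` closure \<Omega>) \<and>
    visc_subsolution p \<epsilon> \<Omega> u \<and>
    visc_supersolution p \<epsilon> \<Omega> u \<and>
    (\<forall>x\<in>frontier \<Omega>. u x = 1)"

end

theory Submission
  imports Defs
begin

text \<open>
  Compare \<open>u\<close> with the barriers \<open>c + b exp (a s)\<close>, where \<open>s y = sqrt (\<bar>y - w\<bar>\<^sup>2 + \<eta>\<^sup>2)\<close>. On a
  radial function the operator is linear up to a first order term, so \<open>exp (\<plusminus> k s / \<epsilon>)\<close> is a strict
  super- or subsolution for small \<open>\<epsilon>\<close> as soon as \<open>k\<^sup>2 < p'\<close> or \<open>k\<^sup>2 > p'\<close>, respectively.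
  A strict barrier that is smooth is itself a test function, so no general comparison principle is
  needed. The growing barrier with \<open>\<eta>\<close> large gives \<open>0 \<le> u \<le> 1\<close> by penalization at infinity;
  centred at \<open>x\<close> in the ball of radius \<open>d\<^sub>\<Gamma>(x)\<close> it bounds \<open>u(x)\<close> from above. The decaying barrier with
  \<open>\<eta> = 0\<close>, centred at an exterior point close to a nearest boundary point of \<open>x\<close> (this is where
  \<open>\<Gamma> = \<partial>(\<real>\<^sup>N - closure \<Omega>)\<close> enters), bounds it from below.
\<close>

section \<open>Sign symmetry: exchanging sub- and supersolutions\<close>

lemma uminus_matrix_vector_mult: "(- A) *v x = - (A *v x)"
  for A :: "real^'n^'m"
  by (simp add: matrix_vector_mult_def vec_eq_iff sum_negf)

text \<open>The gradient enters quadratically and the Hessian linearly, so both forms of the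
  operator are odd in the pair. On the reals \<open>Inf\<close> is by definition the negated
  \<open>Sup\<close> of the negated set, hence no boundedness has to be checked.\<close>

lemma game_plap_upper_uminus:
  "game_plap_upper p (- g) (- H) = - game_plap_lower p g H"
proof -
  have "game_plap p (- g) (- H) = - game_plap p g H"
    by (simp add: game_plap_def trace_def sum_negf matrix_vector_mult_def inner_vec_def algebra_simps)
  moreover have "game_plap_dir p (- H) = (\<lambda>e. - game_plap_dir p H e)"
    by (simp add: fun_eq_iff game_plap_dir_def trace_def sum_negf uminus_matrix_vector_mult algebra_simps)
  ultimately show ?thesis
    by (simp add: game_plap_upper_def game_plap_lower_def Inf_real_def image_image)
qed

lemma C2_with_uminus:
  assumes "C2_with \<Omega> \<phi> G H"
  shows "C2_with \<Omega> (\<lambda>x. - \<phi> x) (\<lambda>x. - G x) (\<lambda>x. - H x)"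
  using assms unfolding C2_with_def gderiv_def
  by (auto intro!: derivative_eq_intros continuous_intros simp: uminus_matrix_vector_mult)

text \<open>Through this symmetry the lower bounds on \<open>u\<close> become upper bounds on
  \<open>- u\<close>, and a comparison lemma for subsolutions alone suffices.\<close>

lemma visc_subsolution_uminus:
  assumes "visc_supersolution p \<epsilon> \<Omega> u"
  shows "visc_subsolution p \<epsilon> \<Omega> (\<lambda>x. - u x)"
  unfolding visc_subsolution_def
proof (intro allI impI ballI)
  fix \<phi> G H x
  assume C2: "C2_with \<Omega> \<phi> G H" and x: "x \<in> \<Omega>"
    and max: "\<forall>\<^sub>F y in nhds x. - u y - \<phi> y \<le> - u x - \<phi> x"
  have "\<forall>\<^sub>F y in nhds x. u x - - \<phi> x \<le> u y - - \<phi> y"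
    using max by eventually_elim simp
  then have "\<epsilon>\<^sup>2 * game_plap_lower p (- G x) (- H x) \<le> u x"
    using assms C2_with_uminus[OF C2] x unfolding visc_supersolution_def by blast
  then show "- u x \<le> \<epsilon>\<^sup>2 * game_plap_upper p (G x) (H x)"
    using game_plap_upper_uminus[of p "- G x" "- H x"] by simp
qed

section \<open>The operator on radial functions\<close>

text \<open>The Hessian of a radial function about \<open>w\<close> is \<open>\<alpha> I + \<beta> q q\<^sup>T\<close> with \<open>q = y - w\<close>.\<close>

definition outer :: "real^'n \<Rightarrow> real^'n^'n"
  where "outer q = (\<chi> i j. q $ i * q $ j)"

lemma outer_mult_vec: "outer q *v h = (q \<bullet> h) *\<^sub>R q"
  by (simp add: outer_def vec_eq_iff matrix_vector_mult_def inner_vec_def sum_distrib_left mult_ac)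

lemma trace_outer: "trace (outer q) = q \<bullet> q"
  by (simp add: outer_def trace_def inner_vec_def)

lemma trace_scaleR: "trace (c *\<^sub>R A) = c * trace (A :: real^'n^'n)"
  by (simp add: trace_def sum_distrib_left)

lemma isotropic_plus_outer_mult_vec:
  "(\<alpha> *\<^sub>R mat 1 + \<beta> *\<^sub>R outer q) *v h = \<alpha> *\<^sub>R h + (\<beta> * (q \<bullet> h)) *\<^sub>R q"
  for h :: "real^'n"
  by (simp add: matrix_vector_mult_add_rdistrib scaleR_matrix_vector_assoc[symmetric] outer_mult_vec)

lemma trace_isotropic_plus_outer:
  "trace (\<alpha> *\<^sub>R mat 1 + \<beta> *\<^sub>R outer q) = \<alpha> * real CARD('n) + \<beta> * (norm q)\<^sup>2"
  for q :: "real^'n"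
  by (simp add: trace_add trace_scaleR trace_outer trace_I power2_norm_eq_inner)

text \<open>For \<open>q \<noteq> 0\<close> the gradient direction is an eigenvector of the Hessian
  with eigenvalue \<open>\<alpha> + \<beta> * (norm q)\<^sup>2\<close>. For \<open>q = 0\<close> the
  Hessian is isotropic, so the bracket is constant on the sphere and the envelope yields the same
  formula: the centre needs no separate treatment later.\<close>

lemma game_plap_upper_radial:
  fixes q :: "real^'n" and p :: ereal
  defines "\<theta> \<equiv> real_of_ereal (1 / p)"
  assumes "\<alpha> \<noteq> 0"
  shows "game_plap_upper p (\<alpha> *\<^sub>R q) (\<alpha> *\<^sub>R mat 1 + \<beta> *\<^sub>R outer q) =
    \<alpha> * (1 + (real CARD('n) - 2) * \<theta>) + \<beta> * (norm q)\<^sup>2 * (1 - \<theta>)"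
proof (cases "q = 0")
  case True
  have "game_plap_dir p (\<alpha> *\<^sub>R mat 1 + \<beta> *\<^sub>R outer q) e = \<alpha> * (1 + (real CARD('n) - 2) * \<theta>)"
    if "e \<in> sphere 0 1" for e
    using that True
    by (simp add: game_plap_dir_def isotropic_plus_outer_mult_vec trace_isotropic_plus_outer
        \<theta>_def norm_eq_1 flip: power2_norm_eq_inner) (simp add: algebra_simps)
  moreover have "sphere (0::real^'n) 1 \<noteq> {}"
    by simp
  ultimately show ?thesis
    using True by (simp add: game_plap_upper_def)
next
  case False
  have "((\<alpha> *\<^sub>R mat 1 + \<beta> *\<^sub>R outer q) *v (\<alpha> *\<^sub>R q)) \<bullet> (\<alpha> *\<^sub>R q) / (norm (\<alpha> *\<^sub>R q))\<^sup>2
      = \<alpha> + \<beta> * (norm q)\<^sup>2"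
    using False assms unfolding power2_norm_eq_inner
    by (simp add: isotropic_plus_outer_mult_vec inner_add_left field_simps)
  then show ?thesis
    using False assms
    by (simp add: game_plap_upper_def game_plap_def trace_isotropic_plus_outer algebra_simps)
qed

text \<open>The profile is a function of the squared distance, which is smooth at the centre too;
  the rest is the chain rule.\<close>

lemma C2_with_radial:
  fixes w :: "real^'n" and F F' F'' :: "real \<Rightarrow> real"
  assumes F: "\<And>y. y \<in> \<Omega> \<Longrightarrow> (F has_real_derivative F' ((norm (y - w))\<^sup>2)) (at ((norm (y - w))\<^sup>2))"
    and F': "\<And>y. y \<in> \<Omega> \<Longrightarrow> (F' has_real_derivative F'' ((norm (y - w))\<^sup>2)) (at ((norm (y - w))\<^sup>2))"
    and F'': "continuous_on ((\<lambda>y. (norm (y - w))\<^sup>2) ` \<Omega>) F''"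
  shows "C2_with \<Omega> (\<lambda>y. F ((norm (y - w))\<^sup>2))
    (\<lambda>y. (2 * F' ((norm (y - w))\<^sup>2)) *\<^sub>R (y - w))
    (\<lambda>y. (2 * F' ((norm (y - w))\<^sup>2)) *\<^sub>R mat 1 + (4 * F'' ((norm (y - w))\<^sup>2)) *\<^sub>R outer (y - w))"
proof -
  define T where "T y = (norm (y - w))\<^sup>2" for y
  have T: "(T has_derivative (\<lambda>h. 2 * ((y - w) \<bullet> h))) (at y)" for y
    unfolding T_def power2_norm_eq_inner
    by (auto intro!: derivative_eq_intros simp: inner_commute)
  have DF: "((\<lambda>y. F (T y)) has_derivative (\<lambda>h. F' (T y) * (2 * ((y - w) \<bullet> h)))) (at y)"
    if "y \<in> \<Omega>" for y
    using has_derivative_compose[OF T F[OF that, folded T_def, unfolded has_field_derivative_def]]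
    by simp
  have DF': "((\<lambda>y. F' (T y)) has_derivative (\<lambda>h. F'' (T y) * (2 * ((y - w) \<bullet> h)))) (at y)"
    if "y \<in> \<Omega>" for y
    using has_derivative_compose[OF T F'[OF that, folded T_def, unfolded has_field_derivative_def]]
    by simp
  have "((\<lambda>y. (2 * F' (T y)) *\<^sub>R (y - w)) has_derivative
      (\<lambda>h. ((2 * F' (T y)) *\<^sub>R mat 1 + (4 * F'' (T y)) *\<^sub>R outer (y - w)) *v h)) (at y)"
    if "y \<in> \<Omega>" for y
    by (auto intro!: derivative_eq_intros DF' that simp: isotropic_plus_outer_mult_vec)
  moreover have "GDERIV (\<lambda>y. F (T y)) y :> (2 * F' (T y)) *\<^sub>R (y - w)" if "y \<in> \<Omega>" for y
    unfolding gderiv_def using DF[OF that] by (simp add: inner_commute mult_ac)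
  moreover have "continuous_on \<Omega> (\<lambda>y. F' (T y))"
    using DF' by (meson continuous_at_imp_continuous_on has_derivative_continuous)
  moreover have "continuous_on \<Omega> (\<lambda>y. F'' (T y))"
    using F'' by (intro continuous_on_compose2[where g = F'' and f = T])
      (auto simp: T_def intro!: continuous_intros)
  moreover have "continuous_on \<Omega> (\<lambda>y. outer (y - w))"
    unfolding outer_def by (intro continuous_intros)
  ultimately show ?thesis
    unfolding C2_with_def T_def by (auto intro!: continuous_intros)
qed

section \<open>Comparison with smooth strict barriers\<close>

text \<open>Where \<open>u - \<psi>\<close> has a positive maximum, \<open>\<psi>\<close> itself is
  an admissible test function, and the subsolution inequality contradicts strictness. Coercivity
  replaces compactness of \<open>closure W\<close>. The set \<open>W\<close> is kept apart from
  \<open>\<Omega>\<close> so that the comparison can also be made on a ball.\<close>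

lemma visc_comparison:
  fixes u \<psi> :: "real^'n \<Rightarrow> real"
  assumes sub: "visc_subsolution p \<epsilon> \<Omega> u"
    and C2: "C2_with \<Omega> \<psi> G H"
    and W: "open W" "W \<subseteq> \<Omega>"
    and cont: "continuous_on (closure W) u" "continuous_on (closure W) \<psi>"
    and bnd: "\<And>x. x \<in> frontier W \<Longrightarrow> u x \<le> \<psi> x"
    and strict: "\<And>x. x \<in> W \<Longrightarrow> \<epsilon>\<^sup>2 * game_plap_upper p (G x) (H x) < \<psi> x"
    and coercive: "\<And>c. c > 0 \<Longrightarrow> bounded {x \<in> closure W. c \<le> u x - \<psi> x}"
    and x: "x \<in> closure W"
  shows "u x \<le> \<psi> x"
proof (rule ccontr)
  assume "\<not> u x \<le> \<psi> x"
  define c where "c = u x - \<psi> x"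
  have "c > 0"
    using \<open>\<not> u x \<le> \<psi> x\<close> by (simp add: c_def)
  \<comment> \<open>Only points of this superlevel set compete with \<open>x\<close>; everywhere
    else the difference is below \<open>c\<close>. A maximum over the compact set \<open>K\<close>
    is thus a maximum over \<open>closure W\<close>.\<close>
  define K where "K = {y \<in> closure W. c \<le> u y - \<psi> y}"
  have cd: "continuous_on (closure W) (\<lambda>y. u y - \<psi> y)"
    by (intro continuous_intros cont)
  have "K = closure W \<inter> (\<lambda>y. u y - \<psi> y) -` {c..}"
    by (auto simp: K_def)
  then have "closed K"
    using continuous_closed_preimage[OF cd closed_closure closed_atLeast] by simp
  then have "compact K"
    using coercive[OF \<open>c > 0\<close>] by (simp add: K_def compact_eq_bounded_closed)
  moreover have "x \<in> K"
    using x by (simp add: K_def c_def)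
  moreover have "continuous_on K (\<lambda>y. u y - \<psi> y)"
    using cd by (rule continuous_on_subset) (auto simp: K_def)
  ultimately obtain z where z: "z \<in> K" "\<And>y. y \<in> K \<Longrightarrow> u y - \<psi> y \<le> u z - \<psi> z"
    using continuous_attains_sup[of K "\<lambda>y. u y - \<psi> y"] by blast
  have pos: "u z > \<psi> z"
    using z(1) \<open>c > 0\<close> by (simp add: K_def)
  then have "z \<in> W"
    using z(1) bnd[of z] W(1) by (auto simp: K_def frontier_def interior_open)
  moreover have "u y - \<psi> y \<le> u z - \<psi> z" if "y \<in> W" for y
    using z(1) z(2)[of y] that closure_subset[of W] by (force simp: K_def)
  ultimately have "\<forall>\<^sub>F y in nhds z. u y - \<psi> y \<le> u z - \<psi> z"
    using W(1) by (auto simp: eventually_nhds)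
  then have "u z \<le> \<epsilon>\<^sup>2 * game_plap_upper p (G z) (H z)"
    using sub C2 \<open>z \<in> W\<close> W(2) unfolding visc_subsolution_def by blast
  then show False
    using strict[OF \<open>z \<in> W\<close>] pos by simp
qed

section \<open>Exponential barriers\<close>

text \<open>The assumption \<open>off\<close> keeps \<open>s\<close> positive, hence smooth, on
  \<open>\<Omega>\<close>: either \<open>\<eta>\<close> rounds off the tip of the cone or the tip
  lies outside. Nonzero \<open>a\<close> and \<open>b\<close> make the gradient vanish at the centre
  only, as \<open>game_plap_upper_radial\<close> requires.\<close>

lemma exp_barrier:
  fixes w :: "real^'n" and a b c \<eta> :: real and p :: ereal
  defines "\<theta> \<equiv> real_of_ereal (1 / p)" and "s \<equiv> \<lambda>y. sqrt ((norm (y - w))\<^sup>2 + \<eta>\<^sup>2)"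
  assumes "a \<noteq> 0" "b \<noteq> 0" and off: "\<eta> \<noteq> 0 \<or> w \<notin> \<Omega>"
  obtains G H where "C2_with \<Omega> (\<lambda>y. c + b * exp (a * s y)) G H"
    and "\<And>y. y \<in> \<Omega> \<Longrightarrow> game_plap_upper p (G y) (H y) = b * exp (a * s y) *
      (a / s y * (1 + (real CARD('n) - 2) * \<theta>)
        + (a\<^sup>2 / (s y)\<^sup>2 - a / (s y) ^ 3) * (norm (y - w))\<^sup>2 * (1 - \<theta>))"
proof -
  define S where "S t = sqrt (t + \<eta>\<^sup>2)" for t
  define F where "F t = c + b * exp (a * S t)" for t
  define F' where "F' t = b * exp (a * S t) * (a / (2 * S t))" for t
  define F'' where "F'' t = b * exp (a * S t) * (a\<^sup>2 / (4 * (S t)\<^sup>2) - a / (4 * (S t) ^ 3))" for t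
  have pos: "(norm (y - w))\<^sup>2 + \<eta>\<^sup>2 > 0" if "y \<in> \<Omega>" for y
    using off that by (auto simp: sum_power2_gt_zero_iff)
  have dS: "(S has_real_derivative 1 / (2 * S t)) (at t)" if "t + \<eta>\<^sup>2 > 0" for t
    unfolding S_def using that by (auto intro!: derivative_eq_intros simp: field_simps)
  have dF: "(F has_real_derivative F' t) (at t)" if "t + \<eta>\<^sup>2 > 0" for t
    unfolding F_def F'_def by (rule derivative_eq_intros dS that refl | simp)+
  have dF': "(F' has_real_derivative F'' t) (at t)" if "t + \<eta>\<^sup>2 > 0" for t
  proof -
    have "S t > 0"
      using that by (simp add: S_def)
    then show ?thesis
      unfolding F'_def F''_def
      by (auto intro!: derivative_eq_intros dS that simp: field_simps power2_eq_square power3_eq_cube)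
  qed
  have "continuous_on ((\<lambda>y. (norm (y - w))\<^sup>2) ` \<Omega>) F''"
    unfolding F''_def S_def using pos
    by (intro continuous_intros) (force simp: less_imp_neq[symmetric])+
  from C2_with_radial[of \<Omega> F F' w F'', OF dF[OF pos] dF'[OF pos] this]
  have C2: "C2_with \<Omega> (\<lambda>y. c + b * exp (a * s y))
      (\<lambda>y. (2 * F' ((norm (y - w))\<^sup>2)) *\<^sub>R (y - w))
      (\<lambda>y. (2 * F' ((norm (y - w))\<^sup>2)) *\<^sub>R mat 1 + (4 * F'' ((norm (y - w))\<^sup>2)) *\<^sub>R outer (y - w))"
    unfolding F_def S_def s_def .
  show thesis
  proof (rule that[OF C2])
    fix y assume "y \<in> \<Omega>"
    then have s: "s y > 0"
      unfolding s_def by (intro real_sqrt_gt_zero pos)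
    have S: "S ((norm (y - w))\<^sup>2) = s y"
      by (simp add: S_def s_def)
    have "2 * F' ((norm (y - w))\<^sup>2) \<noteq> 0"
      unfolding F'_def S using \<open>a \<noteq> 0\<close> \<open>b \<noteq> 0\<close> s by simp
    then show "game_plap_upper p ((2 * F' ((norm (y - w))\<^sup>2)) *\<^sub>R (y - w))
        ((2 * F' ((norm (y - w))\<^sup>2)) *\<^sub>R mat 1 + (4 * F'' ((norm (y - w))\<^sup>2)) *\<^sub>R outer (y - w)) =
      b * exp (a * s y) * (a / s y * (1 + (real CARD('n) - 2) * \<theta>)
        + (a\<^sup>2 / (s y)\<^sup>2 - a / (s y) ^ 3) * (norm (y - w))\<^sup>2 * (1 - \<theta>))"
      unfolding game_plap_upper_radial[OF \<open>2 * F' ((norm (y - w))\<^sup>2) \<noteq> 0\<close>] \<theta>_def[symmetric]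
      using s by (simp add: F'_def F''_def S field_simps)
  qed
qed

text \<open>Divided by the exponential term, the left side is at most the left side of
  \<open>small\<close>, because \<open>s \<ge> \<eta>\<close>, \<open>norm (y - w) \<le> s\<close>,
  and the remaining term is nonpositive. The operator does not see \<open>c\<close>, so the strict
  inequality concerns the exponential term alone.\<close>

lemma growing_barrier:
  fixes w :: "real^'n" and b c k \<eta> \<epsilon> :: real and p :: ereal
  defines "\<theta> \<equiv> real_of_ereal (1 / p)" and "s \<equiv> \<lambda>y. sqrt ((norm (y - w))\<^sup>2 + \<eta>\<^sup>2)"
  assumes "b > 0" "k > 0" "\<eta> > 0" "\<epsilon> > 0" "0 \<le> \<theta>" "\<theta> < 1" "CARD('n) \<ge> 2"
    and small: "\<epsilon> * k * (1 + (real CARD('n) - 2) * \<theta>) / \<eta> + k\<^sup>2 * (1 - \<theta>) < 1"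
  obtains G H where "C2_with \<Omega> (\<lambda>y. c + b * exp (k / \<epsilon> * s y)) G H"
    and "\<And>y. y \<in> \<Omega> \<Longrightarrow> \<epsilon>\<^sup>2 * game_plap_upper p (G y) (H y) < b * exp (k / \<epsilon> * s y)"
proof -
  define C where "C = 1 + (real CARD('n) - 2) * \<theta>"
  have "C \<ge> 0"
    using assms by (simp add: C_def)
  obtain G H where C2: "C2_with \<Omega> (\<lambda>y. c + b * exp (k / \<epsilon> * s y)) G H"
    and L: "\<And>y. y \<in> \<Omega> \<Longrightarrow> game_plap_upper p (G y) (H y) = b * exp (k / \<epsilon> * s y) *
      ((k / \<epsilon>) / s y * C
        + ((k / \<epsilon>)\<^sup>2 / (s y)\<^sup>2 - (k / \<epsilon>) / (s y) ^ 3) * (norm (y - w))\<^sup>2 * (1 - \<theta>))"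
    using exp_barrier[of "k / \<epsilon>" b \<eta> w \<Omega> c p] assms unfolding C_def by auto
  show thesis
  proof (rule that[OF C2])
    fix y assume y: "y \<in> \<Omega>"
    have s: "s y \<ge> \<eta>"
      by (simp add: s_def real_le_rsqrt)
    with \<open>\<eta> > 0\<close> have "s y > 0"
      by linarith
    have "(norm (y - w))\<^sup>2 / (s y)\<^sup>2 \<le> 1"
      using \<open>s y > 0\<close> by (simp add: divide_le_eq_1_pos) (simp add: s_def)
    then have 1: "k\<^sup>2 * (1 - \<theta>) * ((norm (y - w))\<^sup>2 / (s y)\<^sup>2) \<le> k\<^sup>2 * (1 - \<theta>)"
      using \<open>\<theta> < 1\<close> by (intro mult_left_le) auto
    have 2: "\<epsilon> * k * C / s y \<le> \<epsilon> * k * C / \<eta>"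
      using s \<open>s y > 0\<close> assms \<open>C \<ge> 0\<close> by (intro divide_left_mono) auto
    have 3: "0 \<le> \<epsilon> * k * (1 - \<theta>) * (norm (y - w))\<^sup>2 / (s y) ^ 3"
      using s \<open>s y > 0\<close> assms by simp
    have "\<epsilon>\<^sup>2 * ((k / \<epsilon>) / s y * C
        + ((k / \<epsilon>)\<^sup>2 / (s y)\<^sup>2 - (k / \<epsilon>) / (s y) ^ 3) * (norm (y - w))\<^sup>2 * (1 - \<theta>))
      = \<epsilon> * k * C / s y + k\<^sup>2 * (1 - \<theta>) * ((norm (y - w))\<^sup>2 / (s y)\<^sup>2)
        - \<epsilon> * k * (1 - \<theta>) * (norm (y - w))\<^sup>2 / (s y) ^ 3"
      using \<open>s y > 0\<close> \<open>\<epsilon> > 0\<close> by (simp add: field_simps power2_eq_square power3_eq_cube)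
    also have "\<dots> < 1"
      using 1 2 3 small unfolding C_def[symmetric] by linarith
    finally show "\<epsilon>\<^sup>2 * game_plap_upper p (G y) (H y) < b * exp (k / \<epsilon> * s y)"
      unfolding L[OF y] using \<open>b > 0\<close>
      by (simp add: mult.left_commute[of "\<epsilon>\<^sup>2"])
  qed
qed

text \<open>This is the case \<open>\<eta> = 0\<close> with negative \<open>a\<close> and
  \<open>b\<close>, meant for comparison with \<open>- u\<close>. The quotient of operator and
  barrier exceeds 1 by \<open>large\<close>, and multiplication by the negative barrier turns this
  into the required upper bound. The gap \<open>r\<close> controls the first order term.\<close>

lemma decaying_barrier:
  fixes w :: "real^'n" and b k r \<epsilon> :: real and p :: ereal
  defines "\<theta> \<equiv> real_of_ereal (1 / p)"
  assumes "b > 0" "k > 0" "r > 0" "\<epsilon> > 0" "0 \<le> \<theta>" "\<theta> < 1" "CARD('n) \<ge> 2"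
    and far: "\<And>y. y \<in> \<Omega> \<Longrightarrow> r \<le> norm (y - w)"
    and large: "k\<^sup>2 * (1 - \<theta>) - \<epsilon> * k * (1 + (real CARD('n) - 2) * \<theta>) / r > 1"
  obtains G H where "C2_with \<Omega> (\<lambda>y. - b * exp (- (k / \<epsilon>) * norm (y - w))) G H"
    and "\<And>y. y \<in> \<Omega> \<Longrightarrow>
      \<epsilon>\<^sup>2 * game_plap_upper p (G y) (H y) < - b * exp (- (k / \<epsilon>) * norm (y - w))"
proof -
  define C where "C = 1 + (real CARD('n) - 2) * \<theta>"
  have "C \<ge> 0"
    using assms by (simp add: C_def)
  have "w \<notin> \<Omega>"
    using far[of w] \<open>r > 0\<close> by auto
  then obtain G H where C2: "C2_with \<Omega> (\<lambda>y. - b * exp (- (k / \<epsilon>) * norm (y - w))) G H"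
    and L: "\<And>y. y \<in> \<Omega> \<Longrightarrow>
      game_plap_upper p (G y) (H y) = - b * exp (- (k / \<epsilon>) * norm (y - w)) *
      (- (k / \<epsilon>) / norm (y - w) * C
        + ((- (k / \<epsilon>))\<^sup>2 / (norm (y - w))\<^sup>2 - (- (k / \<epsilon>)) / (norm (y - w)) ^ 3)
          * (norm (y - w))\<^sup>2 * (1 - \<theta>))"
    using exp_barrier[of "- (k / \<epsilon>)" "- b" 0 w \<Omega> 0 p] assms unfolding C_def
    by (auto simp: real_sqrt_unique)
  show thesis
  proof (rule that[OF C2])
    fix y assume y: "y \<in> \<Omega>"
    define \<rho> where "\<rho> = norm (y - w)"
    have \<rho>: "\<rho> \<ge> r" "\<rho> > 0"
      using far[OF y] \<open>r > 0\<close> by (auto simp: \<rho>_def)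
    have 1: "\<epsilon> * k * C / \<rho> \<le> \<epsilon> * k * C / r"
      using \<rho> assms \<open>C \<ge> 0\<close> by (intro divide_left_mono) auto
    have 2: "0 \<le> \<epsilon> * k * (1 - \<theta>) / \<rho>"
      using \<rho> assms by simp
    have "1 < k\<^sup>2 * (1 - \<theta>) - \<epsilon> * k * C / \<rho> + \<epsilon> * k * (1 - \<theta>) / \<rho>"
      using 1 2 large unfolding C_def[symmetric] by linarith
    also have "\<dots> = \<epsilon>\<^sup>2 * (- (k / \<epsilon>) / \<rho> * C
        + ((- (k / \<epsilon>))\<^sup>2 / \<rho>\<^sup>2 - (- (k / \<epsilon>)) / \<rho> ^ 3) * \<rho>\<^sup>2 * (1 - \<theta>))"
      using \<rho> \<open>\<epsilon> > 0\<close> by (simp add: field_simps power2_eq_square power3_eq_cube)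
    finally show "\<epsilon>\<^sup>2 * game_plap_upper p (G y) (H y) < - b * exp (- (k / \<epsilon>) * norm (y - w))"
      unfolding L[OF y] \<rho>_def[symmetric] using \<open>b > 0\<close>
      by (simp add: mult.left_commute[of "\<epsilon>\<^sup>2"])
  qed
qed

section \<open>Bounds for solutions\<close>

text \<open>A maximum principle for possibly unbounded domains: a small multiple of a growing
  barrier, added to \<open>c\<close>, forces the maximum to be attained. It is used for
  \<open>u\<close> with \<open>c = 1\<close> and for \<open>- u\<close> with
  \<open>c = 0\<close>.\<close>

lemma visc_subsolution_le_boundary:
  fixes u :: "real^'n \<Rightarrow> real" and p :: ereal
  defines "\<theta> \<equiv> real_of_ereal (1 / p)"
  assumes p: "0 \<le> \<theta>" "\<theta> < 1" "CARD('n) \<ge> 2" and "\<epsilon> > 0"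
    and sub: "visc_subsolution p \<epsilon> \<Omega> u" and "open \<Omega>"
    and cont: "continuous_on (closure \<Omega>) u" and "bounded (u ` closure \<Omega>)"
    and bnd: "\<And>x. x \<in> frontier \<Omega> \<Longrightarrow> u x \<le> c" and "c \<ge> 0"
    and x: "x \<in> closure \<Omega>"
  shows "u x \<le> c"
proof (rule ccontr)
  assume "\<not> u x \<le> c"
  define C where "C = 1 + (real CARD('n) - 2) * \<theta>"
  have "C > 0"
    using p by (simp add: C_def add_pos_nonneg)
  \<comment> \<open>With these values the two terms of the smallness condition are
    \<open>1/8\<close> and at most \<open>1/4\<close>, for every
    \<open>\<epsilon> > 0\<close>.\<close>
  define k :: real where "k = 1 / 2"
  define \<eta> where "\<eta> = 4 * \<epsilon> * C"
  have k: "k > 0" and \<eta>: "\<eta> > 0"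
    using \<open>\<epsilon> > 0\<close> \<open>C > 0\<close> by (auto simp: k_def \<eta>_def)
  have "\<epsilon> * k * C / \<eta> + k\<^sup>2 * (1 - \<theta>) < 1"
    using p(1) \<open>\<epsilon> > 0\<close> \<open>C > 0\<close> by (simp add: k_def \<eta>_def power2_eq_square field_simps)
  note small = this[unfolded C_def \<theta>_def]
  define s where "s y = sqrt ((norm (y - 0))\<^sup>2 + \<eta>\<^sup>2)" for y :: "real^'n"
  \<comment> \<open>The penalty at \<open>x\<close> is half of the supposed excess
    \<open>u x - c\<close>, so one comparison gives a contradiction without letting
    \<open>\<delta>\<close> tend to 0.\<close>
  define \<delta> where "\<delta> = (u x - c) / (2 * exp (k / \<epsilon> * s x))"
  have \<delta>: "\<delta> > 0" "\<delta> * exp (k / \<epsilon> * s x) = (u x - c) / 2"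
    using \<open>\<not> u x \<le> c\<close> by (auto simp: \<delta>_def)
  obtain G H where C2: "C2_with \<Omega> (\<lambda>y. c + \<delta> * exp (k / \<epsilon> * s y)) G H"
    and strict: "\<And>y. y \<in> \<Omega> \<Longrightarrow> \<epsilon>\<^sup>2 * game_plap_upper p (G y) (H y) < \<delta> * exp (k / \<epsilon> * s y)"
    using growing_barrier[OF \<delta>(1) k \<eta> \<open>\<epsilon> > 0\<close> p[unfolded \<theta>_def] small] unfolding s_def by blast
  obtain M where M: "\<And>y. y \<in> closure \<Omega> \<Longrightarrow> u y \<le> M"
    using \<open>bounded (u ` closure \<Omega>)\<close> unfolding bounded_iff by (force simp: abs_le_iff)
  have "u x \<le> c + \<delta> * exp (k / \<epsilon> * s x)"
  proof (rule visc_comparison[OF sub C2 \<open>open \<Omega>\<close> order_refl cont _ _ _ _ x])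
    show "continuous_on (closure \<Omega>) (\<lambda>y. c + \<delta> * exp (k / \<epsilon> * s y))"
      unfolding s_def by (intro continuous_intros)
    show "u y \<le> c + \<delta> * exp (k / \<epsilon> * s y)" if "y \<in> frontier \<Omega>" for y
      using bnd[OF that] \<delta>(1) by (simp add: add_increasing2)
    show "\<epsilon>\<^sup>2 * game_plap_upper p (G y) (H y) < c + \<delta> * exp (k / \<epsilon> * s y)" if "y \<in> \<Omega>" for y
      using strict[OF that] \<open>c \<ge> 0\<close> by linarith
    \<comment> \<open>Here \<open>u \<le> M\<close> bounds the exponential, and an exponential
      exceeds its argument, which gives an explicit radius.\<close>
    show "bounded {y \<in> closure \<Omega>. e \<le> u y - (c + \<delta> * exp (k / \<epsilon> * s y))}" if "e > 0" for e
    proof (rule boundedI)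
      fix y assume "y \<in> {y \<in> closure \<Omega>. e \<le> u y - (c + \<delta> * exp (k / \<epsilon> * s y))}"
      then have "\<delta> * exp (k / \<epsilon> * s y) \<le> M"
        using M[of y] \<open>e > 0\<close> \<open>c \<ge> 0\<close> by auto
      then have "exp (k / \<epsilon> * s y) \<le> M / \<delta>"
        using \<delta>(1) by (simp add: field_simps)
      moreover have "k / \<epsilon> * s y < exp (k / \<epsilon> * s y)"
        by (rule less_le_trans[OF _ exp_ge_add_one_self]) simp
      ultimately have "k / \<epsilon> * s y \<le> M / \<delta>"
        by linarith
      then have "s y \<le> M / \<delta> * \<epsilon> / k"
        using k \<open>\<epsilon> > 0\<close> \<delta>(1) by (simp add: field_simps)
      moreover have "norm y \<le> s y"
        by (simp add: s_def)
      ultimately show "norm y \<le> M / \<delta> * \<epsilon> / k"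
        by linarith
    qed
  qed
  then show False
    using \<delta>(2) \<open>\<not> u x \<le> c\<close> by simp
qed

text \<open>The factor \<open>b\<close> makes the growing barrier equal to 1 on the sphere of radius
  \<open>R\<close>, where \<open>u \<le> 1\<close>. The bound is its value at the centre, where
  \<open>s\<close> is \<open>\<eta>\<close>.\<close>

lemma visc_subsolution_center_le:
  fixes u :: "real^'n \<Rightarrow> real" and p :: ereal
  defines "\<theta> \<equiv> real_of_ereal (1 / p)"
  assumes p: "0 \<le> \<theta>" "\<theta> < 1" "CARD('n) \<ge> 2" and \<epsilon>: "\<epsilon> > 0"
    and sub: "visc_subsolution p \<epsilon> \<Omega> u" and cont: "continuous_on (closure \<Omega>) u"
    and le1: "\<And>y. y \<in> closure \<Omega> \<Longrightarrow> u y \<le> 1"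
    and ball: "ball x R \<subseteq> \<Omega>" and "R > 0" and k: "k > 0" and \<eta>: "\<eta> > 0"
    and small: "\<epsilon> * k * (1 + (real CARD('n) - 2) * \<theta>) / \<eta> + k\<^sup>2 * (1 - \<theta>) < 1"
  shows "u x \<le> exp (- (k / \<epsilon>) * (sqrt (R\<^sup>2 + \<eta>\<^sup>2) - \<eta>))"
proof -
  define s where "s y = sqrt ((norm (y - x))\<^sup>2 + \<eta>\<^sup>2)" for y
  define b where "b = exp (- (k / \<epsilon>) * sqrt (R\<^sup>2 + \<eta>\<^sup>2))"
  have "b > 0"
    by (simp add: b_def)
  from growing_barrier[OF this k \<eta> \<epsilon> p[unfolded \<theta>_def] small[unfolded \<theta>_def], of \<Omega> 0 x]
  obtain G H where C2: "C2_with \<Omega> (\<lambda>y. b * exp (k / \<epsilon> * s y)) G H"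
    and strict: "\<And>y. y \<in> \<Omega> \<Longrightarrow> \<epsilon>\<^sup>2 * game_plap_upper p (G y) (H y) < b * exp (k / \<epsilon> * s y)"
    unfolding s_def by auto
  have cball: "closure (ball x R) \<subseteq> closure \<Omega>"
    using ball by (rule closure_mono)
  have "u x \<le> b * exp (k / \<epsilon> * s x)"
  proof (rule visc_comparison[OF sub C2 open_ball ball])
    show "continuous_on (closure (ball x R)) u"
      using cont cball by (rule continuous_on_subset)
    show "continuous_on (closure (ball x R)) (\<lambda>y. b * exp (k / \<epsilon> * s y))"
      unfolding s_def by (intro continuous_intros)
    show "u y \<le> b * exp (k / \<epsilon> * s y)" if "y \<in> frontier (ball x R)" for y
    proof -
      have "y \<in> closure \<Omega>"
        using that cball by (auto simp: frontier_def)
      moreover have "norm (y - x) = R"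
        using that \<open>R > 0\<close> by (simp add: dist_norm norm_minus_commute)
      ultimately show ?thesis
        using le1[of y] by (simp add: s_def b_def flip: exp_add)
    qed
    show "\<epsilon>\<^sup>2 * game_plap_upper p (G y) (H y) < b * exp (k / \<epsilon> * s y)" if "y \<in> ball x R" for y
      using strict that ball by blast
    show "bounded {y \<in> closure (ball x R). c \<le> u y - b * exp (k / \<epsilon> * s y)}" for c
      by (rule bounded_subset[OF bounded_closure[OF bounded_ball[of x R]]]) auto
    show "x \<in> closure (ball x R)"
      using \<open>R > 0\<close> closure_subset[of "ball x R"] by force
  qed
  also have "s x = \<eta>"
    using \<eta> by (simp add: s_def)
  finally show ?thesis
    by (simp add: b_def algebra_simps flip: exp_add)
qed

text \<open>The decaying barrier, normalized to 1 at distance \<open>r\<close> from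
  \<open>w\<close>, is at most 1 on the boundary since \<open>closure \<Omega>\<close> stays at
  least that far away.\<close>

lemma visc_supersolution_exterior_ball_ge:
  fixes u :: "real^'n \<Rightarrow> real" and p :: ereal
  defines "\<theta> \<equiv> real_of_ereal (1 / p)"
  assumes p: "0 \<le> \<theta>" "\<theta> < 1" "CARD('n) \<ge> 2" and \<epsilon>: "\<epsilon> > 0"
    and super: "visc_supersolution p \<epsilon> \<Omega> u" and "open \<Omega>"
    and cont: "continuous_on (closure \<Omega>) u"
    and nonneg: "\<And>y. y \<in> closure \<Omega> \<Longrightarrow> 0 \<le> u y"
    and bnd: "\<And>y. y \<in> frontier \<Omega> \<Longrightarrow> 1 \<le> u y"
    and r: "r > 0" and far: "\<And>y. y \<in> closure \<Omega> \<Longrightarrow> r \<le> norm (y - w)"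
    and k: "k > 0"
    and large: "k\<^sup>2 * (1 - \<theta>) - \<epsilon> * k * (1 + (real CARD('n) - 2) * \<theta>) / r > 1"
    and x: "x \<in> closure \<Omega>"
  shows "exp (- (k / \<epsilon>) * (norm (x - w) - r)) \<le> u x"
proof -
  define b where "b = exp (k / \<epsilon> * r)"
  have b: "b > 0"
    by (simp add: b_def)
  have far': "\<And>y. y \<in> \<Omega> \<Longrightarrow> r \<le> norm (y - w)"
    using far closure_subset by blast
  obtain G H where C2: "C2_with \<Omega> (\<lambda>y. - b * exp (- (k / \<epsilon>) * norm (y - w))) G H"
    and strict: "\<And>y. y \<in> \<Omega> \<Longrightarrow>
      \<epsilon>\<^sup>2 * game_plap_upper p (G y) (H y) < - b * exp (- (k / \<epsilon>) * norm (y - w))"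
    using decaying_barrier[OF b k r \<epsilon> p[unfolded \<theta>_def] far' large[unfolded \<theta>_def]] by blast
  have "- u x \<le> - b * exp (- (k / \<epsilon>) * norm (x - w))"
  proof (rule visc_comparison[OF visc_subsolution_uminus[OF super] C2 \<open>open \<Omega>\<close> order_refl])
    show "continuous_on (closure \<Omega>) (\<lambda>y. - u y)"
      by (intro continuous_intros cont)
    show "continuous_on (closure \<Omega>) (\<lambda>y. - b * exp (- (k / \<epsilon>) * norm (y - w)))"
      by (intro continuous_intros)
    show "- u y \<le> - b * exp (- (k / \<epsilon>) * norm (y - w))" if "y \<in> frontier \<Omega>" for y
    proof -
      have "r \<le> norm (y - w)"
        using far[of y] that by (simp add: frontier_def)
      then have "b * exp (- (k / \<epsilon>) * norm (y - w)) \<le> 1"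
        using k \<epsilon> by (simp add: b_def mult_left_mono divide_right_mono flip: exp_add)
      with bnd[OF that] show ?thesis
        by simp
    qed
    show "\<epsilon>\<^sup>2 * game_plap_upper p (G y) (H y) < - b * exp (- (k / \<epsilon>) * norm (y - w))"
      if "y \<in> \<Omega>" for y
      using strict[OF that] .
    \<comment> \<open>As \<open>u\<close> is nonnegative, the difference can reach \<open>c\<close>
      only where the barrier is at least \<open>c\<close>, and the barrier decays.\<close>
    show "bounded {y \<in> closure \<Omega>. c \<le> - u y - - b * exp (- (k / \<epsilon>) * norm (y - w))}"
      if "c > 0" for c
    proof (rule bounded_subset[OF bounded_cball[of w "b / c * \<epsilon> / k"]], safe)
      fix y assume "y \<in> closure \<Omega>" "c \<le> - u y - - b * exp (- (k / \<epsilon>) * norm (y - w))"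
      then have "c \<le> b * exp (- (k / \<epsilon>) * norm (y - w))"
        using nonneg[of y] by simp
      then have "exp (k / \<epsilon> * norm (y - w)) \<le> b / c"
        using \<open>c > 0\<close> by (simp add: exp_minus field_simps)
      moreover have "k / \<epsilon> * norm (y - w) < exp (k / \<epsilon> * norm (y - w))"
        by (rule less_le_trans[OF _ exp_ge_add_one_self]) simp
      ultimately have "k / \<epsilon> * norm (y - w) \<le> b / c"
        by linarith
      then show "y \<in> cball w (b / c * \<epsilon> / k)"
        using k \<epsilon> \<open>c > 0\<close> by (simp add: dist_norm norm_minus_commute field_simps)
    qed
  qed (rule x)
  then show ?thesis
    by (simp add: b_def algebra_simps flip: exp_add)
qed

section \<open>Distance to the boundary and the limit\<close>

text \<open>A ball is connected, so if it met both \<open>S\<close> and the complement it would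
  contain a frontier point closer than the infimum.\<close>

lemma ball_infdist_frontier_subset:
  fixes x :: "'a::real_normed_vector"
  assumes "x \<in> S"
  shows "ball x (infdist x (frontier S)) \<subseteq> S"
proof (rule ccontr)
  assume *: "\<not> ball x (infdist x (frontier S)) \<subseteq> S"
  \<comment> \<open>Radius 0 would make the ball empty and the inclusion trivial, so the radius is
    positive.\<close>
  then have "x \<in> ball x (infdist x (frontier S)) \<inter> S"
    using assms ball_eq_empty by fastforce
  with * have "ball x (infdist x (frontier S)) \<inter> frontier S \<noteq> {}"
    using connected_Int_frontier[OF connected_ball] by blast
  then obtain z where "z \<in> frontier S" "dist x z < infdist x (frontier S)"
    by auto
  then show False
    using infdist_le[of z "frontier S" x] by simp
qed

theorem theorem2p5:
  fixes p :: ereal and p' :: real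
    and \<Omega> :: "(real^'n) set"
    and u :: "real \<Rightarrow> real^'n \<Rightarrow> real"
  assumes "1 < p"
    and "1 / p + 1 / ereal p' = 1"
    and "CARD('n) \<ge> 2"
    and "open \<Omega>" and "connected \<Omega>"
    and "frontier \<Omega> \<noteq> {}"
    and "frontier \<Omega> = frontier (UNIV - closure \<Omega>)"
    and "\<And>\<epsilon>. \<epsilon> > 0 \<Longrightarrow> bounded_visc_solution p \<epsilon> \<Omega> (u \<epsilon>)"
  shows "\<forall>x\<in>closure \<Omega>.
    (\<forall>\<epsilon>>0. u \<epsilon> x > 0) \<and>
    ((\<lambda>\<epsilon>. \<epsilon> * ln (u \<epsilon> x)) \<longlongrightarrow> - sqrt p' * infdist x (frontier \<Omega>)) (at_right 0)"
proof
  fix x assume x: "x \<in> closure \<Omega>"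
  define \<theta> where "\<theta> = real_of_ereal (1 / p)"
  \<comment> \<open>The value \<open>p' = 0\<close> is impossible because \<open>1 / 0\<close> is
    infinite in the extended reals. For infinite \<open>p\<close> the result is
    \<open>\<theta> = 0\<close> and \<open>p' = 1\<close>.\<close>
  have "0 \<le> \<theta> \<and> \<theta> < 1 \<and> p' > 0 \<and> 1 - \<theta> = 1 / p'"
  proof (cases p)
    case (real q)
    with assms(1,2) have "q > 1" "p' \<noteq> 0" "1 / q + 1 / p' = 1"
      by (cases "p' = 0"; simp add: one_ereal_def)+
    moreover from this have "1 / p' > 0"
      by (smt (verit) divide_less_eq_1_pos)
    ultimately show ?thesis
      using real by (simp add: \<theta>_def one_ereal_def)
  next
    case PInf
    with assms(2) show ?thesis
      by (cases "p' = 0") (auto simp: \<theta>_def one_ereal_def)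
  next
    case MInf
    with assms(1) show ?thesis
      by simp
  qed
  then have \<theta>: "0 \<le> \<theta>" "\<theta> < 1" and "p' > 0" "1 - \<theta> = 1 / p'"
    by auto
  note p = \<theta>[unfolded \<theta>_def] assms(3)
  \<comment> \<open>This is the critical rate: up to terms of order \<open>\<epsilon>\<close>,
    growing barriers need \<open>k < \<sigma>\<close> and decaying ones
    \<open>k > \<sigma>\<close>.\<close>
  define \<sigma> where "\<sigma> = sqrt p'"
  have \<sigma>: "\<sigma> > 0" "\<sigma>\<^sup>2 * (1 - \<theta>) = 1"
    using \<open>p' > 0\<close> \<open>1 - \<theta> = 1 / p'\<close> by (auto simp: \<sigma>_def)
  define C where "C = 1 + (real CARD('n) - 2) * \<theta>"
  define d where "d = infdist x (frontier \<Omega>)"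
  have "d \<ge> 0"
    by (simp add: d_def infdist_nonneg)
  have cont: "continuous_on (closure \<Omega>) (u \<epsilon>)" and bnded: "bounded (u \<epsilon> ` closure \<Omega>)"
    and sub: "visc_subsolution p \<epsilon> \<Omega> (u \<epsilon>)" and super: "visc_supersolution p \<epsilon> \<Omega> (u \<epsilon>)"
    and bnd: "\<And>y. y \<in> frontier \<Omega> \<Longrightarrow> u \<epsilon> y = 1" if "\<epsilon> > 0" for \<epsilon>
    using assms(8)[OF that] unfolding bounded_visc_solution_def by auto
  have le1: "u \<epsilon> y \<le> 1" if "\<epsilon> > 0" "y \<in> closure \<Omega>" for \<epsilon> y
    using visc_subsolution_le_boundary[OF p that(1) sub[OF that(1)] assms(4) cont[OF that(1)]
        bnded[OF that(1)] _ _ that(2), of 1] bnd[OF that(1)] by simp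
  have nonneg: "0 \<le> u \<epsilon> y" if "\<epsilon> > 0" "y \<in> closure \<Omega>" for \<epsilon> y
  proof -
    have "bounded ((\<lambda>y. - u \<epsilon> y) ` closure \<Omega>)"
      using bnded[OF that(1)] by (simp add: bounded_iff)
    then have "- u \<epsilon> y \<le> 0"
      using visc_subsolution_le_boundary[OF p that(1) visc_subsolution_uminus[OF super[OF that(1)]]
          assms(4) _ _ _ _ that(2), of 0] cont[OF that(1)] bnd[OF that(1)]
      by (simp add: continuous_on_minus)
    then show ?thesis
      by simp
  qed
  have lower: "exp (- (k / \<epsilon>) * (norm (x - w) - r)) \<le> u \<epsilon> x"
    if "\<epsilon> > 0" "r > 0" "\<And>y. y \<in> closure \<Omega> \<Longrightarrow> r \<le> norm (y - w)" "k > 0"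
      "k\<^sup>2 * (1 - \<theta>) - \<epsilon> * k * C / r > 1" for \<epsilon> k w r
    using visc_supersolution_exterior_ball_ge[OF p that(1) super[OF that(1)] assms(4)
        cont[OF that(1)] nonneg[OF that(1)] _ that(2,3,4) that(5)[unfolded C_def \<theta>_def] x]
      bnd[OF that(1)] by simp
  \<comment> \<open>The assumption on the frontier puts the boundary point nearest to
    \<open>x\<close> in the closure of the exterior, so exterior centres lie arbitrarily close to
    it.\<close>
  have exterior: "\<exists>w r. r > 0 \<and> norm (x - w) < d + t \<and> (\<forall>y\<in>closure \<Omega>. r \<le> norm (y - w))"
    if "t > 0" for t
  proof -
    obtain z where z: "z \<in> frontier \<Omega>" "dist x z = d"
      using infdist_attains_inf[OF frontier_closed[of \<Omega>] assms(6), of x] unfolding d_def by metis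
    then have "z \<in> closure (- closure \<Omega>)"
      using assms(7) unfolding frontier_def Compl_eq_Diff_UNIV by blast
    then obtain w where w: "w \<notin> closure \<Omega>" "dist w z < t"
      using \<open>t > 0\<close> unfolding closure_approachable[of z "- closure \<Omega>"] by auto
    then obtain r where r: "r > 0" "ball w r \<subseteq> - closure \<Omega>"
      using open_contains_ball[of "- closure \<Omega>"] by auto
    have "r \<le> norm (y - w)" if "y \<in> closure \<Omega>" for y
      using r(2) that by (force simp: dist_norm norm_minus_commute)
    moreover have "norm (x - w) < d + t"
      using dist_triangle[of x w z] z(2) w(2) by (simp add: dist_norm norm_minus_commute)
    ultimately show ?thesis
      using r(1) by blast
  qed
  have pos: "u \<epsilon> x > 0" if "\<epsilon> > 0" for \<epsilon>
  proof -
    obtain w r where w: "r > 0" "\<And>y. y \<in> closure \<Omega> \<Longrightarrow> r \<le> norm (y - w)"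
      using exterior[of 1] by auto
    define m where "m = \<epsilon> * C / r"
    \<comment> \<open>For fixed \<open>\<epsilon>\<close> the first order term is not small, so
      \<open>k\<close> is taken large instead. The condition reads
      \<open>k * (k * (1 - \<theta>) - m) > 1\<close>, and the choice below makes both factors
      exceed 1.\<close>
    have "m \<ge> 0"
      using \<open>\<epsilon> > 0\<close> \<open>r > 0\<close> \<theta>(1) assms(3) by (simp add: m_def C_def)
    define k where "k = 1 + (m + 1) / (1 - \<theta>)"
    have "k > 1"
      using \<open>m \<ge> 0\<close> \<theta>(2) by (simp add: k_def)
    have "k * (1 - \<theta>) - m = 1 - \<theta> + 1"
      using \<theta>(2) by (simp add: k_def field_simps)
    then have "k * (k * (1 - \<theta>) - m) > 1 * 1"
      using \<open>k > 1\<close> \<theta>(2) by (intro mult_strict_mono) auto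
    then have "k\<^sup>2 * (1 - \<theta>) - \<epsilon> * k * C / r > 1" "k > 0"
      using \<open>k > 1\<close> by (auto simp: m_def power2_eq_square algebra_simps)
    then show ?thesis
      using lower[OF that w] by (meson exp_gt_zero less_le_trans)
  qed
  moreover have "((\<lambda>\<epsilon>. \<epsilon> * ln (u \<epsilon> x)) \<longlongrightarrow> - \<sigma> * d) (at_right 0)"
  proof (rule order_tendstoI)
    fix a assume a: "a < - \<sigma> * d"
    \<comment> \<open>One parameter \<open>t\<close> measures both the excess of the rate over
      \<open>\<sigma>\<close> and the error in the distance. It is fixed first, since
      \<open>w\<close> and \<open>r\<close> depend on it; then \<open>\<epsilon>\<close> tends to
      0.\<close>
    have "((\<lambda>t. - (\<sigma> + t) * (d + t)) \<longlongrightarrow> - (\<sigma> + 0) * (d + 0)) (at_right 0)"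
      by (intro tendsto_intros)
    then have "\<forall>\<^sub>F t in at_right 0. a < - (\<sigma> + t) * (d + t)"
      using a by (intro order_tendstoD) auto
    then have "\<forall>\<^sub>F t in at_right 0. 0 < t \<and> a < - (\<sigma> + t) * (d + t)"
      using eventually_at_right_less[of "0::real"] by eventually_elim simp
    then obtain t where t: "t > 0" "a < - (\<sigma> + t) * (d + t)"
      using eventually_happens'[OF trivial_limit_at_right_real] by blast
    obtain w r where w: "r > 0" "norm (x - w) < d + t" "\<And>y. y \<in> closure \<Omega> \<Longrightarrow> r \<le> norm (y - w)"
      using exterior[OF t(1)] by blast
    define k where "k = \<sigma> + t"
    have "k > 0"
      using t(1) \<sigma>(1) by (simp add: k_def)
    have "\<sigma>\<^sup>2 < k\<^sup>2"
      using t(1) \<sigma>(1) by (intro power_strict_mono) (auto simp: k_def)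
    then have "k\<^sup>2 * (1 - \<theta>) > 1"
      using \<sigma>(2) \<theta>(2) by (metis diff_gt_0_iff_gt mult_strict_right_mono)
    moreover have "((\<lambda>\<epsilon>. k\<^sup>2 * (1 - \<theta>) - \<epsilon> * k * C / r) \<longlongrightarrow> k\<^sup>2 * (1 - \<theta>) - 0 * k * C / r) (at_right 0)"
      using \<open>r > 0\<close> by (intro tendsto_intros) auto
    ultimately have "\<forall>\<^sub>F \<epsilon> in at_right 0. 1 < k\<^sup>2 * (1 - \<theta>) - \<epsilon> * k * C / r"
      by (intro order_tendstoD) auto
    then show "\<forall>\<^sub>F \<epsilon> in at_right 0. a < \<epsilon> * ln (u \<epsilon> x)"
      using eventually_at_right_less[of "0::real"]
    proof eventually_elim
      fix \<epsilon> :: real assume \<epsilon>: "1 < k\<^sup>2 * (1 - \<theta>) - \<epsilon> * k * C / r" "0 < \<epsilon>"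
      have "ln (exp (- (k / \<epsilon>) * (norm (x - w) - r))) \<le> ln (u \<epsilon> x)"
        by (subst ln_le_cancel_iff) (use lower[OF \<epsilon>(2) w(1,3) \<open>k > 0\<close> \<epsilon>(1)] pos[OF \<epsilon>(2)] in auto)
      then have "\<epsilon> * (- (k / \<epsilon>) * (norm (x - w) - r)) \<le> \<epsilon> * ln (u \<epsilon> x)"
        using \<epsilon>(2) by (simp only: ln_exp mult_left_mono[OF _ less_imp_le])
      moreover have "\<epsilon> * (- (k / \<epsilon>) * (norm (x - w) - r)) = - k * (norm (x - w) - r)"
        using \<epsilon>(2) by simp
      moreover have "k * (norm (x - w) - r) \<le> k * (d + t)"
        using w(1,2) \<open>k > 0\<close> by (intro mult_left_mono) auto
      ultimately show "a < \<epsilon> * ln (u \<epsilon> x)"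
        using t(2) unfolding k_def[symmetric] by (simp add: algebra_simps)
    qed
  next
    fix a assume a: "- \<sigma> * d < a"
    show "\<forall>\<^sub>F \<epsilon> in at_right 0. \<epsilon> * ln (u \<epsilon> x) < a"
    \<comment> \<open>On the boundary the target is 0 and \<open>u \<le> 1\<close> suffices;
      otherwise a ball of positive radius \<open>d\<close> fits into
      \<open>\<Omega>\<close>.\<close>
    proof (cases "d = 0")
      case True
      show ?thesis
        using eventually_at_right_less[of "0::real"]
      proof eventually_elim
        fix \<epsilon> :: real assume "0 < \<epsilon>"
        then have "\<epsilon> * ln (u \<epsilon> x) \<le> 0"
          using le1[OF _ x, of \<epsilon>] pos[of \<epsilon>] by (simp add: mult_nonneg_nonpos)
        then show "\<epsilon> * ln (u \<epsilon> x) < a"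
          using a True by simp
      qed
    next
      case False
      with \<open>d \<ge> 0\<close> have "d > 0"
        by simp
      then have "x \<notin> frontier \<Omega>"
        by (auto simp: d_def)
      then have "x \<in> \<Omega>"
        using x assms(4) by (auto simp: frontier_def interior_open)
      then have ball: "ball x d \<subseteq> \<Omega>"
        unfolding d_def by (rule ball_infdist_frontier_subset)
      \<comment> \<open>Again one parameter has two uses: \<open>t\<close> is the deficit of the
        rate below \<open>\<sigma>\<close> and the smoothing \<open>\<eta>\<close> of the
        barrier.\<close>
      have "((\<lambda>t. - (\<sigma> - t) * (sqrt (d\<^sup>2 + t\<^sup>2) - t)) \<longlongrightarrow> - (\<sigma> - 0) * (sqrt (d\<^sup>2 + 0\<^sup>2) - 0)) (at_right 0)"
        by (intro tendsto_intros)
      then have "\<forall>\<^sub>F t in at_right 0. - (\<sigma> - t) * (sqrt (d\<^sup>2 + t\<^sup>2) - t) < a"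
        using a \<open>d > 0\<close> by (intro order_tendstoD) auto
      moreover have "\<forall>\<^sub>F t in at_right 0. t < \<sigma>"
        using \<sigma>(1) by (auto simp: eventually_at_right_field)
      ultimately have "\<forall>\<^sub>F t in at_right 0. 0 < t \<and> t < \<sigma> \<and> - (\<sigma> - t) * (sqrt (d\<^sup>2 + t\<^sup>2) - t) < a"
        using eventually_at_right_less[of "0::real"] by eventually_elim simp
      then obtain t where t: "0 < t" "t < \<sigma>" "- (\<sigma> - t) * (sqrt (d\<^sup>2 + t\<^sup>2) - t) < a"
        using eventually_happens'[OF trivial_limit_at_right_real] by blast
      define k where "k = \<sigma> - t"
      have "k > 0"
        using t(2) by (simp add: k_def)
      have "k\<^sup>2 < \<sigma>\<^sup>2"
        using t(1,2) by (intro power_strict_mono) (auto simp: k_def)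
      then have "k\<^sup>2 * (1 - \<theta>) < 1"
        using \<sigma>(2) \<theta>(2) by (metis diff_gt_0_iff_gt mult_strict_right_mono)
      moreover have "((\<lambda>\<epsilon>. \<epsilon> * k * C / t + k\<^sup>2 * (1 - \<theta>)) \<longlongrightarrow> 0 * k * C / t + k\<^sup>2 * (1 - \<theta>)) (at_right 0)"
        using \<open>t > 0\<close> by (intro tendsto_intros) auto
      ultimately have "\<forall>\<^sub>F \<epsilon> in at_right 0. \<epsilon> * k * C / t + k\<^sup>2 * (1 - \<theta>) < 1"
        by (intro order_tendstoD) auto
      then show ?thesis
        using eventually_at_right_less[of "0::real"]
      proof eventually_elim
        fix \<epsilon> :: real assume \<epsilon>: "\<epsilon> * k * C / t + k\<^sup>2 * (1 - \<theta>) < 1" "0 < \<epsilon>"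
        have "u \<epsilon> x \<le> exp (- (k / \<epsilon>) * (sqrt (d\<^sup>2 + t\<^sup>2) - t))"
          by (rule visc_subsolution_center_le[OF p \<epsilon>(2) sub[OF \<epsilon>(2)] cont[OF \<epsilon>(2)] le1[OF \<epsilon>(2)]
                ball \<open>d > 0\<close> \<open>k > 0\<close> t(1) \<epsilon>(1)[unfolded C_def \<theta>_def]])
        then have "ln (u \<epsilon> x) \<le> ln (exp (- (k / \<epsilon>) * (sqrt (d\<^sup>2 + t\<^sup>2) - t)))"
          by (subst ln_le_cancel_iff) (use pos[OF \<epsilon>(2)] in auto)
        then have "\<epsilon> * ln (u \<epsilon> x) \<le> \<epsilon> * (- (k / \<epsilon>) * (sqrt (d\<^sup>2 + t\<^sup>2) - t))"
          using \<epsilon>(2) by (simp only: ln_exp mult_left_mono[OF _ less_imp_le])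
        also have "\<dots> = - (\<sigma> - t) * (sqrt (d\<^sup>2 + t\<^sup>2) - t)"
          using \<epsilon>(2) unfolding k_def[symmetric] by simp
        also note t(3)
        finally show "\<epsilon> * ln (u \<epsilon> x) < a" .
      qed
    qed
  qed
  ultimately show "(\<forall>\<epsilon>>0. u \<epsilon> x > 0) \<and>
      ((\<lambda>\<epsilon>. \<epsilon> * ln (u \<epsilon> x)) \<longlongrightarrow> - sqrt p' * infdist x (frontier \<Omega>)) (at_right 0)"
    unfolding \<sigma>_def d_def by blast
qed

end
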